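(* Let $\Pi^*=\{\pi^*_{ij}\mid (i,j)\in\mathcal{E}\}$ be the (unique) optimal assignment over a bipartite graph $\mathcal{G}=(\mathcal{V},\mathcal{E})$ with weights $\mathcal{W}$, and let $\mathcal{S}=\{s_{ij}\mid (i,j)\in\mathcal{E}\}$ be the element-wise sensitivities of $\mathcal{W}$ with respect to $\Pi^*$. Let $N$ be the maximal number of assigned edges in an assignment over $\mathcal{G}$. Then the perturbation $$\Delta:=\Big\{\delta_{ij}=\frac{s_{ij}}{2N}\ \Big|\ (i,j)\in\mathcal{E}\Big\}$$ is an allowable perturbation, i.e. $\Pi^*\in LAP(\mathcal{G},\mathcal{W}+\Delta)$.
   Context: $\mathcal{G}=(\mathcal{V},\mathcal{E})$ is a finite bipartite graph with $\mathcal{V}=\mathcal{V}_A\cup\mathcal{V}_T$, $\mathcal{V}_A\cap\mathcal{V}_T=\emptyset$, $\mathcal{E}\subseteq\mathcal{V}_A\times\mathcal{V}_T$ and $|\mathcal{V}_A|\ge|\mathcal{V}_T|\ge 1$ ($\mathcal{V}_A$ = agents, $\mathcal{V}_T$ = tasks). Edge weights are real numbers $\mathcal{W}=\{w_{ij}\in\mathbb{R}\mid (i,j)\in\mathcal{E}\}$. An assignment is a family $\Pi=\{\pi_{ij}\in\{0,1\}\mid (i,j)\in\mathcal{E}\}$ satisfying $\sum_{i:(i,j)\in\mathcal{E}}\pi_{ij}=1$ for every $j\in\mathcal{V}_T$ and $\sum_{j:(i,j)\in\mathcal{E}}\pi_{ij}\le 1$ for every $i\in\mathcal{V}_A$. Edge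 $(i,j)$ is assigned in $\Pi$ if $\pi_{ij}=1$. The cost is $f(\mathcal{W},\Pi)=\sum_{(i,j)\in\mathcal{E}}\pi_{ij}w_{ij}$. $LAP(\mathcal{G},\mathcal{W})$ denotes the set of assignments minimizing $f(\mathcal{W},\cdot)$ over all assignments. Standing assumption: the optimal assignment for the initial weights is unique, i.e. $LAP(\mathcal{G},\mathcal{W})=\{\Pi^*\}$. A perturbation is a family of real numbers $\Delta=\{\delta_{ij}\mid (i,j)\in\mathcal{E}\}$, and $\mathcal{W}+\Delta:=\{w_{ij}+\delta_{ij}\mid (i,j)\in\mathcal{E}\}$. A perturbation $\Delta$ is called allowable if $\Pi^*\in LAP(\mathcal{G},\mathcal{W}+\Delta)$ (the optimizer for the perturbed weights need not be unique). Element-wise sensitivities: for $(a,b)\in\mathcal{E}$ let $\Pi_{ab}$ be a minimizer of $f(\mathcal{W},\Pi)$ over all assignments $\Pi$ with $\pi_{ab}\ne\pi^*_{ab}$ (so edge $(a,b)$ is forced if it is not in $\Pi^*$, and blocked if it is in $\Pi^*$). It is assumed that for every $(a,b)\in\mathcal{E}$ at least one such assignment exists, so that $s_{ab}$ is well defined. Then $$s_{ab}=\begin{cases} f(\mathcal{W},\Pi^* )-f(\mathcal{W},\Pi_{ab}) & \text{if }\pi^*_{ab}=0,\\ f(\mathcal{W},\Pi_{ab})-f(\mathcal{W},\Pi^* ) & \text{if }\pi^*_{ab}=1.\end{cases}$$ *)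

theory Defs
  imports Complex_Main "HOL-Library.FuncSet"
begin

text \<open>
  A bipartite graph is given by its agents \<open>VA\<close>, its tasks \<open>VT\<close> and its edges
  \<open>E \<subseteq> VA \<times> VT\<close>; agents and tasks are vertices of one common type.
  Weights and perturbations are functions on pairs of vertices, of which only the values
  on \<open>E\<close> are ever used.
\<close>

definition bipartite_graph :: "'v set \<Rightarrow> 'v set \<Rightarrow> ('v \<times> 'v) set \<Rightarrow> bool" where
  "bipartite_graph VA VT E \<longleftrightarrow>
     finite VA \<and> finite VT \<and> VA \<inter> VT = {} \<and> E \<subseteq> VA \<times> VT \<and>
     card VA \<ge> card VT \<and> card VT \<ge> 1"

text \<open>
  Families indexed by \<open>E\<close> are extensional functions, so that two assignments that agree
  on \<open>E\<close> are equal. This is what makes uniqueness of the optimal assignment expressible as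
  \<open>LAP VA VT E w = {P}\<close>.
\<close>

definition assignments ::
  "'v set \<Rightarrow> 'v set \<Rightarrow> ('v \<times> 'v) set \<Rightarrow> ('v \<times> 'v \<Rightarrow> real) set" where
  "assignments VA VT E =
     {P \<in> E \<rightarrow>\<^sub>E {0, 1}.
        (\<forall>j\<in>VT. (\<Sum>i | (i, j) \<in> E. P (i, j)) = 1) \<and>
        (\<forall>i\<in>VA. (\<Sum>j | (i, j) \<in> E. P (i, j)) \<le> 1)}"

definition cost :: "('v \<times> 'v) set \<Rightarrow> ('v \<times> 'v \<Rightarrow> real) \<Rightarrow> ('v \<times> 'v \<Rightarrow> real) \<Rightarrow> real" where
  "cost E w P = (\<Sum>e\<in>E. P e * w e)"

definition minimizers ::
  "('v \<times> 'v) set \<Rightarrow> ('v \<times> 'v \<Rightarrow> real) \<Rightarrow> ('v \<times> 'v \<Rightarrow> real) set \<Rightarrow> ('v \<times> 'v \<Rightarrow> real) set" where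
  "minimizers E w F = {P \<in> F. \<forall>Q\<in>F. cost E w P \<le> cost E w Q}"

definition LAP ::
  "'v set \<Rightarrow> 'v set \<Rightarrow> ('v \<times> 'v) set \<Rightarrow> ('v \<times> 'v \<Rightarrow> real) \<Rightarrow> ('v \<times> 'v \<Rightarrow> real) set" where
  "LAP VA VT E w = minimizers E w (assignments VA VT E)"

definition allowable ::
  "'v set \<Rightarrow> 'v set \<Rightarrow> ('v \<times> 'v) set \<Rightarrow> ('v \<times> 'v \<Rightarrow> real) \<Rightarrow> ('v \<times> 'v \<Rightarrow> real) \<Rightarrow>
     ('v \<times> 'v \<Rightarrow> real) \<Rightarrow> bool" where
  "allowable VA VT E w P \<delta> \<longleftrightarrow> P \<in> LAP VA VT E (\<lambda>e. w e + \<delta> e)"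

definition alternatives ::
  "'v set \<Rightarrow> 'v set \<Rightarrow> ('v \<times> 'v) set \<Rightarrow> ('v \<times> 'v \<Rightarrow> real) \<Rightarrow> 'v \<times> 'v \<Rightarrow>
     ('v \<times> 'v \<Rightarrow> real) set" where
  "alternatives VA VT E P e = {Q \<in> assignments VA VT E. Q e \<noteq> P e}"

text \<open>
  In the next definition \<open>Q e\<close> is the chosen cheapest assignment among those that differ
  from \<open>P\<close> on \<open>e\<close>; the value does not depend on which minimizer is chosen.
\<close>

definition sensitivity ::
  "('v \<times> 'v) set \<Rightarrow> ('v \<times> 'v \<Rightarrow> real) \<Rightarrow> ('v \<times> 'v \<Rightarrow> real) \<Rightarrow>
     ('v \<times> 'v \<Rightarrow> 'v \<times> 'v \<Rightarrow> real) \<Rightarrow> 'v \<times> 'v \<Rightarrow> real" where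
  "sensitivity E w P Q e =
     (if P e = 0 then cost E w P - cost E w (Q e) else cost E w (Q e) - cost E w P)"

definition max_assigned :: "'v set \<Rightarrow> 'v set \<Rightarrow> ('v \<times> 'v) set \<Rightarrow> nat" where
  "max_assigned VA VT E = Max ((\<lambda>P. card {e \<in> E. P e = 1}) ` assignments VA VT E)"

lemma finite_assignments:
  assumes "bipartite_graph VA VT E"
  shows "finite (assignments VA VT E)"
proof -
  have "finite E"
    using assms unfolding bipartite_graph_def by (meson finite_SigmaI finite_subset)
  then have "finite (E \<rightarrow>\<^sub>E {0, 1 :: real})"
    by (simp add: finite_PiE)
  then show ?thesis
    by (rule rev_finite_subset) (auto simp: assignments_def)
qed

lemma minimizers_alternatives_nonempty:
  assumes "bipartite_graph VA VT E" and "alternatives VA VT E P e \<noteq> {}"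
  shows "minimizers E w (alternatives VA VT E P e) \<noteq> {}"
proof -
  let ?F = "alternatives VA VT E P e"
  have fin: "finite ?F"
    using finite_assignments[OF assms(1)] by (simp add: alternatives_def)
  let ?Q = "arg_min_on (cost E w) ?F"
  have "?Q \<in> ?F"
    by (rule arg_min_if_finite(1)[OF fin assms(2)])
  moreover have "cost E w ?Q \<le> cost E w R" if "R \<in> ?F" for R
    by (rule arg_min_least[OF fin assms(2) that])
  ultimately have "?Q \<in> minimizers E w ?F"
    unfolding minimizers_def by blast
  then show ?thesis by blast
qed

end

theory Submission
  imports Defs
begin

text \<open>
  Let \<open>P\<close> be an assignment of excess cost \<open>D = cost P - cost Pstar \<ge> 0\<close>. On every edge where
  \<open>P\<close> and \<open>Pstar\<close> differ, \<open>P\<close> competes in the minimization that defines the sensitivity, so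
  switching that edge from \<open>Pstar\<close> to \<open>P\<close> gains at most \<open>D / (2 * N)\<close> from the perturbation.
  They differ on at most \<open>2 * N\<close> edges, hence the total gain is at most \<open>D\<close>.
\<close>

lemma assignment_values:
  assumes "P \<in> assignments VA VT E" "e \<in> E"
  shows "P e = 0 \<or> P e = 1"
  using assms by (auto simp: assignments_def dest: PiE_mem)

text \<open>Values are 0 or 1, so the sum counts the assigned edges.\<close>

lemma sum_assignment_le_max_assigned:
  assumes "bipartite_graph VA VT E" "P \<in> assignments VA VT E"
  shows "sum P E \<le> real (max_assigned VA VT E)"
proof -
  have fin: "finite E"
    using assms(1) unfolding bipartite_graph_def by (meson finite_SigmaI finite_subset)
  have "sum P E = (\<Sum>e\<in>E. if P e = 1 then 1 else 0)"
    using assignment_values[OF assms(2)] by (intro sum.cong) auto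
  also have "\<dots> = real (card {e \<in> E. P e = 1})"
    using fin by (simp flip: sum.inter_filter)
  also have "\<dots> \<le> real (max_assigned VA VT E)"
    unfolding max_assigned_def
    using finite_assignments[OF assms(1)] assms(2) by (intro of_nat_mono Max_ge) auto
  finally show ?thesis .
qed

text \<open>The factor \<open>P e + Pstar e\<close> is 1 wherever the two differ and nonnegative
  elsewhere, so it bounds the indicator of a difference by a term whose sum over \<open>E\<close> is
  easy to control.\<close>

lemma sensitivity_gain_le:
  assumes "P \<in> assignments VA VT E" "Pstar \<in> LAP VA VT E w" "e \<in> E"
    and "Q e \<in> minimizers E w (alternatives VA VT E Pstar e)"
  shows "(Pstar e - P e) * sensitivity E w Pstar Q e
           \<le> (P e + Pstar e) * (cost E w P - cost E w Pstar)"
proof (cases "P e = Pstar e")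
  case True
  have "0 \<le> P e" "cost E w Pstar \<le> cost E w P"
    using assignment_values[OF assms(1,3)] assms(1,2) by (auto simp: LAP_def minimizers_def)
  with True show ?thesis by simp
next
  case False
  have Pstar: "Pstar \<in> assignments VA VT E"
    using assms(2) by (simp add: LAP_def minimizers_def)
  have "cost E w (Q e) \<le> cost E w P"
    using assms(1,4) False by (simp add: minimizers_def alternatives_def)
  \<comment> \<open>The sign of \<open>Pstar e - P e\<close> cancels the sign convention of
    \<open>sensitivity\<close>: in both cases the left side is
    \<open>cost E w (Q e) - cost E w Pstar\<close>.\<close>
  then show ?thesis
    using False assignment_values[OF assms(1,3)] assignment_values[OF Pstar assms(3)]
    by (auto simp: sensitivity_def)
qed

theorem proposition1:
  fixes VA VT :: "'v set"
    and E :: "('v \<times> 'v) set"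
    and w Pstar :: "'v \<times> 'v \<Rightarrow> real"
    and Q :: "'v \<times> 'v \<Rightarrow> 'v \<times> 'v \<Rightarrow> real"
  assumes "bipartite_graph VA VT E"
    and "LAP VA VT E w = {Pstar}"
    and "\<And>e. e \<in> E \<Longrightarrow> alternatives VA VT E Pstar e \<noteq> {}"
    and "\<And>e. e \<in> E \<Longrightarrow> Q e \<in> minimizers E w (alternatives VA VT E Pstar e)"
  shows "allowable VA VT E w Pstar
           (\<lambda>e. sensitivity E w Pstar Q e / (2 * real (max_assigned VA VT E)))"
proof -
  let ?s = "sensitivity E w Pstar Q" and ?N = "real (max_assigned VA VT E)"
  let ?v = "\<lambda>e. w e + ?s e / (2 * ?N)"
  have opt: "Pstar \<in> LAP VA VT E w"
    using assms(2) by simp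
  then have Pstar: "Pstar \<in> assignments VA VT E"
    by (simp add: LAP_def minimizers_def)
  have "cost E ?v Pstar \<le> cost E ?v P" if P: "P \<in> assignments VA VT E" for P
  proof -
    define D where "D = cost E w P - cost E w Pstar"
    have D: "0 \<le> D"
      using opt P by (simp add: D_def LAP_def minimizers_def)
    have split: "cost E ?v R = cost E w R + (\<Sum>e\<in>E. R e * ?s e) / (2 * ?N)" for R
      by (simp add: cost_def distrib_left sum.distrib sum_divide_distrib)
    have "(\<Sum>e\<in>E. Pstar e * ?s e) - (\<Sum>e\<in>E. P e * ?s e) = (\<Sum>e\<in>E. (Pstar e - P e) * ?s e)"
      by (simp add: left_diff_distrib sum_subtractf)
    also have "\<dots> \<le> (\<Sum>e\<in>E. (P e + Pstar e) * D)"
      unfolding D_def by (intro sum_mono sensitivity_gain_le[OF P opt] assms(4))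
    also have "\<dots> = (sum P E + sum Pstar E) * D"
      by (simp add: sum.distrib flip: sum_distrib_right)
    \<comment> \<open>Each assignment contributes at most \<open>?N\<close>, which explains the
      factor 2 in the denominator of the perturbation.\<close>
    also have "\<dots> \<le> (2 * ?N) * D"
      using sum_assignment_le_max_assigned[OF assms(1)] P Pstar D
      by (intro mult_right_mono) (smt (verit))+
    finally have "((\<Sum>e\<in>E. Pstar e * ?s e) - (\<Sum>e\<in>E. P e * ?s e)) / (2 * ?N) \<le> D"
      \<comment> \<open>For \<open>?N = 0\<close> the quotient is 0 by the convention on division,
        and \<open>0 \<le> D\<close> suffices.\<close>
      using D by (cases "?N = 0") (auto simp: divide_le_eq mult.commute)
    then show ?thesis
      by (simp add: split D_def diff_divide_distrib)
  qed
  with Pstar show ?thesis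
    by (simp add: allowable_def LAP_def minimizers_def)
qed

end
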